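(* Let $p\ge 5$ be a prime and let $i_0$ be the integer with $1\le i_0\le p-1$ and $24 i_0\equiv -1\pmod p$. Then for all integers $n\ge 1$ and $0\le k\le n-1$, $$\alpha(p,n,i_0,k)=p\left(\frac{12}{p}\right)\bar\xi_p(k),$$ where $\left(\frac{\cdot}{\cdot}\right)$ is the Kronecker symbol.
   Context: For $n\ge 0$ let $(q;q)_n=\prod_{i=1}^n(1-q^i)$ (with $(q;q)_0=1$). Let $F(q)=\sum_{n=0}^\infty (q;q)_n$, and for an integer $N\ge0$ let $F(q,N)=\sum_{n=0}^N (q;q)_n$, a polynomial in $q$ with integer coefficients. For a prime $p$, the polynomials $A_p(N,i,q)\in\mathbb{Z}[q]$ ($0\le i\le p-1$) are defined by the $p$-dissection $$F(q,N)=\sum_{i=0}^{p-1}q^i A_p(N,i,q^p).$$ For $n\ge1$ and $0\le i\le p-1$ the integers $\alpha(p,n,i,k)$ are defined by $$A_p(pn-1,i,1-q)=\sum_{k\ge0}\alpha(p,n,i,k)\,q^k .$$ For a prime $p\ge5$ the integers $\bar\xi_p(n)$ ($n\ge0$) are defined by the formal power series identity $$\sum_{n=0}^\infty\bar\xi_p(n)q^n=(1-q)^{\lfloor p/24\rfloor}F((1-q)^p),$$ where $F((1-q)^p)=\sum_{n=0}^\infty\prod_{i=1}^n(1-(1-q)^{pi})$ is well defined in $\mathbb{Z}[[q]]$ because the $n$-th summand is divisible by $q^n$. *)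

theory Defs
  imports "HOL-Computational_Algebra.Computational_Algebra" "HOL-Number_Theory.Number_Theory"
begin

(* HOL-Algebra has univariate polynomials with constants of the same names,
   hence the qualified names Polynomial.coeff and Polynomial.monom below. *)

definition qpoch :: "'a::comm_ring_1 \<Rightarrow> nat \<Rightarrow> 'a" where
  "qpoch q n = (\<Prod>i = 1..n. 1 - q ^ i)"

definition F_trunc :: "nat \<Rightarrow> int poly" where
  "F_trunc N = (\<Sum>n = 0..N. qpoch (Polynomial.monom 1 1) n)"

definition is_dissection :: "nat \<Rightarrow> int poly \<Rightarrow> (nat \<Rightarrow> int poly) \<Rightarrow> bool" where
  "is_dissection p P A \<longleftrightarrow>
     P = (\<Sum>i<p. Polynomial.monom 1 i * pcompose (A i) (Polynomial.monom 1 p))"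

lemma coeff_pcompose_monom_one:
  assumes "p > 0"
  shows "Polynomial.coeff (pcompose A (Polynomial.monom (1::int) p)) n =
           (if p dvd n then Polynomial.coeff A (n div p) else 0)"
proof (induction A arbitrary: n)
  case 0
  then show ?case by simp
next
  case (pCons a A)
  show ?case
  proof (cases "n < p")
    case True
    have "p dvd n \<longleftrightarrow> n = 0" using True assms by (auto dest: dvd_imp_le)
    then show ?thesis using True assms
      by (simp add: pcompose_pCons Polynomial.coeff_monom_mult Polynomial.coeff_pCons split: nat.splits)
  next
    case False
    then obtain m where m: "n = p + m" by (metis le_add_diff_inverse not_less)
    have "(p + m) div p = Suc (m div p)" using assms by simp
    then show ?thesis using m assms pCons.IH[of m]
      by (simp add: pcompose_pCons Polynomial.coeff_monom_mult Polynomial.coeff_pCons split: nat.splits)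
  qed
qed

lemma coeff_dissection:
  assumes "i < p"
  shows "Polynomial.coeff (\<Sum>j<p. Polynomial.monom 1 j * pcompose (A j) (Polynomial.monom (1::int) p))
           (p * m + i) = Polynomial.coeff (A i) m"
proof -
  have "Polynomial.coeff (Polynomial.monom 1 j * pcompose (A j) (Polynomial.monom (1::int) p)) (p * m + i)
          = (if j = i then Polynomial.coeff (A i) m else 0)" if j: "j < p" for j
  proof (cases "j \<le> p * m + i \<and> p dvd (p * m + i - j)")
    case True
    then have "[p * m + i = j] (mod p)" by (metis cong_altdef_nat)
    then have "j = i" using assms j by (simp add: cong_def)
    then show ?thesis using assms by (simp add: Polynomial.coeff_monom_mult coeff_pcompose_monom_one)
  next
    case False
    then have "j \<noteq> i" by auto
    then show ?thesis using False assms
      by (auto simp add: Polynomial.coeff_monom_mult coeff_pcompose_monom_one)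
  qed
  then have "(\<Sum>j<p. Polynomial.coeff (Polynomial.monom 1 j * pcompose (A j) (Polynomial.monom (1::int) p)) (p * m + i))
      = (\<Sum>j<p. if j = i then Polynomial.coeff (A i) m else 0)"
    by (intro sum.cong) auto
  then show ?thesis using assms by (simp add: Polynomial.coeff_sum)
qed

lemma is_dissection_iff:
  assumes "p > 0"
  shows "is_dissection p P A \<longleftrightarrow>
           (\<forall>i<p. \<forall>m. Polynomial.coeff (A i) m = Polynomial.coeff P (p * m + i))"
proof
  assume "is_dissection p P A"
  then show "\<forall>i<p. \<forall>m. Polynomial.coeff (A i) m = Polynomial.coeff P (p * m + i)"
    by (auto simp only: is_dissection_def coeff_dissection)
next
  assume *: "\<forall>i<p. \<forall>m. Polynomial.coeff (A i) m = Polynomial.coeff P (p * m + i)"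
  show "is_dissection p P A"
    unfolding is_dissection_def
  proof (rule poly_eqI)
    fix n
    have r: "n mod p < p" using assms by simp
    show "Polynomial.coeff P n = Polynomial.coeff
        (\<Sum>i<p. Polynomial.monom 1 i * pcompose (A i) (Polynomial.monom 1 p)) n"
      using coeff_dissection[OF r, of A "n div p"] *[rule_format, OF r, of "n div p"] by simp
  qed
qed

lemma is_dissection_ex1:
  assumes "p > 0"
  shows "\<exists>!A. is_dissection p P A \<and> (\<forall>i\<ge>p. A i = 0)"
proof
  let ?A = "\<lambda>i. if i < p then
    (\<Sum>m\<le>Polynomial.degree P. Polynomial.monom (Polynomial.coeff P (p * m + i)) m) else 0"
  have "Polynomial.coeff P (p * m + i) = 0" if "m > Polynomial.degree P" for i m
  proof -
    have "p * m \<ge> m" using assms by simp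
    then show ?thesis using that by (intro Polynomial.coeff_eq_0) linarith
  qed
  then show "is_dissection p P ?A \<and> (\<forall>i\<ge>p. ?A i = 0)"
    using assms by (auto simp: is_dissection_iff Polynomial.coeff_sum not_le)
next
  let ?A = "\<lambda>i. if i < p then
    (\<Sum>m\<le>Polynomial.degree P. Polynomial.monom (Polynomial.coeff P (p * m + i)) m) else 0"
  fix A assume A: "is_dissection p P A \<and> (\<forall>i\<ge>p. A i = 0)"
  have z: "Polynomial.coeff P (p * m + i) = 0" if "m > Polynomial.degree P" for i m
  proof -
    have "p * m \<ge> m" using assms by simp
    then show ?thesis using that by (intro Polynomial.coeff_eq_0) linarith
  qed
  show "A = ?A"
  proof
    fix i
    show "A i = ?A i"
      using A assms z by (auto simp: is_dissection_iff Polynomial.coeff_sum not_le intro!: poly_eqI)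
  qed
qed

(* The value 0 outside the index range i < p only serves to make the family unique. *)
definition A_poly :: "nat \<Rightarrow> nat \<Rightarrow> nat \<Rightarrow> int poly" where
  "A_poly p N = (THE A. is_dissection p (F_trunc N) A \<and> (\<forall>i\<ge>p. A i = 0))"

lemma A_poly_dissection:
  assumes "p > 0"
  shows "F_trunc N =
    (\<Sum>i<p. Polynomial.monom 1 i * pcompose (A_poly p N i) (Polynomial.monom 1 p))"
proof -
  have "is_dissection p (F_trunc N) (A_poly p N)"
    using theI'[OF is_dissection_ex1[OF assms, of "F_trunc N"]] unfolding A_poly_def by (rule conjunct1)
  then show ?thesis unfolding is_dissection_def .
qed

lemma coeff_A_poly:
  assumes "i < p"
  shows "Polynomial.coeff (A_poly p N i) m = Polynomial.coeff (F_trunc N) (p * m + i)"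
proof -
  have "p > 0" using assms by simp
  show ?thesis
    unfolding A_poly_dissection[OF \<open>p > 0\<close>, of N] coeff_dissection[OF assms] ..
qed

definition alpha :: "nat \<Rightarrow> nat \<Rightarrow> nat \<Rightarrow> nat \<Rightarrow> int" where
  "alpha p n i k = Polynomial.coeff (pcompose (A_poly p (p * n - 1) i) [:1, - 1:]) k"

(* F as a function of a power series: the sum is taken in the topology of int fps, and it
   converges whenever the argument has constant coefficient 1 (see F_fps_sums). *)
definition F_fps :: "int fps \<Rightarrow> int fps" where
  "F_fps f = (\<Sum>n. qpoch f n)"

lemma qpoch_fps_nth_eq_0:
  fixes f :: "int fps"
  assumes "fps_nth f 0 = 1" and "k < n"
  shows "fps_nth (qpoch f n) k = 0"
proof -
  have "fps_X dvd 1 - f ^ i" for i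
  proof -
    have "fps_nth (1 - f ^ i) 0 = 0" using assms(1) by (simp add: fps_power_zeroth)
    then have "1 - f ^ i = fps_X * fps_shift 1 (1 - f ^ i)"
      by (auto simp: fps_eq_iff)
    then show ?thesis by (metis dvd_triv_left)
  qed
  then have "(\<Prod>i = 1..n. fps_X) dvd qpoch f n"
    unfolding qpoch_def by (intro prod_dvd_prod) auto
  then obtain g where "qpoch f n = fps_X ^ n * g" by (auto simp: dvd_def)
  then show ?thesis using assms(2) by (simp add: fps_X_power_mult_nth)
qed

lemma F_fps_sums:
  fixes f :: "int fps"
  assumes "fps_nth f 0 = 1"
  shows "qpoch f sums Abs_fps (\<lambda>k. \<Sum>n\<le>k. fps_nth (qpoch f n) k)"
  unfolding sums_def
proof (rule tendsto_fpsI)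
  fix k
  have "fps_nth (\<Sum>n<N. qpoch f n) k = (\<Sum>n\<le>k. fps_nth (qpoch f n) k)" if "N > k" for N
    unfolding fps_sum_nth using that assms
    by (intro sum.mono_neutral_right) (auto simp: qpoch_fps_nth_eq_0 not_le)
  then show "\<forall>\<^sub>F N in sequentially. fps_nth (\<Sum>n<N. qpoch f n) k =
      fps_nth (Abs_fps (\<lambda>k. \<Sum>n\<le>k. fps_nth (qpoch f n) k)) k"
    by (intro eventually_mono[OF eventually_gt_at_top[of k]]) simp
qed

lemma fps_nth_F_fps:
  assumes "fps_nth f 0 = 1"
  shows "fps_nth (F_fps f) k = (\<Sum>n\<le>k. fps_nth (qpoch f n) k)"
  unfolding F_fps_def sums_unique[OF F_fps_sums[OF assms], symmetric] by simp

definition xi_bar :: "nat \<Rightarrow> nat \<Rightarrow> int" where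
  "xi_bar p n = fps_nth ((1 - fps_X) ^ (p div 24) * F_fps ((1 - fps_X) ^ p)) n"

definition Kronecker_symbol :: "int \<Rightarrow> int \<Rightarrow> int" where
  "Kronecker_symbol a n =
     (if n = 0 then (if \<bar>a\<bar> = 1 then 1 else 0)
      else (if a < 0 \<and> n < 0 then - 1 else 1) *
        (\<Prod>l\<in>#prime_factorization (nat \<bar>n\<bar>).
           if l = 2 then (if even a then 0 else if a mod 8 \<in> {1, 7} then 1 else - 1)
           else Legendre a (int l)))"

lemma Kronecker_symbol_odd_prime:
  assumes "prime p" and "p \<noteq> 2"
  shows "Kronecker_symbol a (int p) = Legendre a (int p)"
  using assms by (auto simp: Kronecker_symbol_def prime_factorization_prime)

end

theory Submission
  imports Defs
begin

text \<open>
  Zagier's ``strange identity'' says that near every root of unity \<open>F(q)\<close> behaves like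
  \<open>-1/2 \<Sum> n (12/n) q\<close> with exponent \<open>(n\<^sup>2 - 1)/24\<close>. The exponents congruent to \<open>i\<^sub>0\<close> modulo \<open>p\<close>
  are those with \<open>p\<close> dividing \<open>n\<close>; on putting \<open>n = p m\<close> the series reproduces itself, with a
  factor \<open>p (12/p)\<close>, a power of \<open>q\<close>, and \<open>q\<close> raised to the power \<open>p\<^sup>2\<close>. In the variable of the
  component this reads: \<open>A\<^sub>p(p n - 1, i\<^sub>0, q)\<close> and \<open>p (12/p) q\<^sup>r F(q\<^sup>p)\<close> with \<open>r = p div 24\<close> agree
  to order \<open>n\<close> at \<open>q = 1\<close>.

  The following proof makes this argument purely algebraic, by congruences between integer
  polynomials modulo powers of \<open>1 - q\<close>. The summands of \<open>F\<close> are deformed by a parameter \<open>x\<close>.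
  At \<open>x = q\<^sup>a\<close> the deformed sum, multiplied by \<open>1 - q\<^sup>a\<close>, is up to small terms and an explicit
  factor a finite section of Euler's pentagonal series (\<open>strange_sum_partial_theta\<close>), and the
  residue class of \<open>i\<^sub>0\<close> extracts from such a section a copy of a shorter one
  (\<open>section_poly_partial_theta\<close>). This relates the component of the deformed sum at
  \<open>x = q\<^sup>p\<^sup>m\<close> to the deformed sum itself, with base \<open>q\<^sup>p\<close>, for every \<open>m \<ge> 1\<close>. The case of
  interest is \<open>m = 0\<close>, where the factor \<open>1 - q\<^sup>a\<close> vanishes and nothing can be read off directly.
  But both sides are polynomials in \<open>q\<^sup>m\<close>, and a high finite difference of such an expression in
  \<open>m\<close> is divisible by a high power of \<open>1 - q\<close>; so the value at \<open>m = 0\<close> is determined by the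
  values at \<open>m \<ge> 1\<close> (\<open>dvd_poly_power_extrapolate\<close>). The derivative with respect to \<open>x\<close> behind
  the factor \<open>n\<close> in the strange identity appears here as the quotient
  \<open>(1 - q\<^sup>p\<^sup>m) / (1 - q\<^sup>m)\<close>, whose value at \<open>m = 0\<close> is \<open>p\<close>.
\<close>

section \<open>The deformed sum at powers of q\<close>

text \<open>
  The parameter \<open>x\<close> deforms the truncated Kontsevich--Zagier sum \<open>\<Sum>n<N. (q; q)\<^sub>n\<close>,
  which is the value at \<open>x = 1\<close>. What the parameter gives is a functional equation under
  \<open>x \<mapsto> x q\<close> and polynomial dependence on \<open>x\<close>.
\<close>
definition strange_sum :: "'a::comm_ring_1 \<Rightarrow> nat \<Rightarrow> 'a \<Rightarrow> 'a" where
  "strange_sum q N x = (\<Sum>n<N. x ^ n * (\<Prod>i = 1..n. 1 - x * q ^ i))"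

text \<open>
  The generalised pentagonal numbers, indexed by all integers. They are the exponents in Euler's
  product and, as \<open>24 pent b + 1 = (6 b + 1)\<^sup>2\<close>, those of the theta series with character
  \<open>(12/n)\<close>.
\<close>
definition pent :: "int \<Rightarrow> nat" where
  "pent b = nat (b * (3 * b + 1) div 2)"

lemma two_pent: "2 * int (pent b) = b * (3 * b + 1)"
proof -
  have "even (b * (3 * b + 1))" by simp
  moreover have "b * (3 * b + 1) \<ge> 0"
    by (cases "b \<ge> 0") (auto intro: mult_nonpos_nonpos)
  ultimately show ?thesis unfolding pent_def by simp
qed

text \<open>
  With \<open>b\<^sub>n\<close> for the product in \<open>c n\<close>, the relation \<open>x q\<^sup>n\<^sup>+\<^sup>2 b\<^sub>n\<^sub>+\<^sub>1 = b\<^sub>n\<^sub>+\<^sub>1 - b\<^sub>n\<^sub>+\<^sub>2\<close>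
  turns the \<open>n\<close>-th summand of the second sum into \<open>x c (n + 1) - c (n + 2)\<close>, while the first one
  contributes \<open>c n - x c n\<close>, so that everything telescopes. The two terms in \<open>c\<close> on the right are
  the price of truncation; they are small when \<open>q\<close> is near a root of unity and \<open>x\<close> is a power
  of \<open>q\<close>.
\<close>
lemma strange_sum_functional_equation:
  fixes q x :: "'a::comm_ring_1"
  defines "c \<equiv> \<lambda>n. x ^ n * (\<Prod>i = 1..n. 1 - x * q ^ i)"
  shows "(1 - x) * strange_sum q N x + q\<^sup>2 * x ^ 3 * ((1 - x * q) * strange_sum q N (x * q))
    = 1 - q * x\<^sup>2 - (1 - x) * c N - c (Suc N)"
proof (induction N)
  case 0
  show ?case by (simp add: strange_sum_def c_def algebra_simps power2_eq_square)
next
  case (Suc N)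
  define b where "b = (\<Prod>i = 1..Suc N. 1 - x * q ^ i)"
  have shift: "(1 - x * q) * (\<Prod>i = 1..N. 1 - x * q * q ^ i) = b"
    unfolding b_def by (simp add: prod.atLeast_Suc_atMost prod.shift_bounds_cl_Suc_ivl mult.assoc
      del: prod.cl_ivl_Suc)
  have "q\<^sup>2 * x ^ 3 * ((1 - x * q) * ((x * q) ^ N * (\<Prod>i = 1..N. 1 - x * q * q ^ i)))
      = q\<^sup>2 * x ^ 3 * (x * q) ^ N * b"
    unfolding shift[symmetric] by (simp only: ac_simps)
  also have "\<dots> = x * c (Suc N) - c (Suc (Suc N))"
    unfolding c_def prod.cl_ivl_Suc[of _ 1 "Suc N"] b_def[symmetric]
    by (simp add: algebra_simps power2_eq_square power3_eq_cube)
  finally have step: "q\<^sup>2 * x ^ 3 * ((1 - x * q) * ((x * q) ^ N * (\<Prod>i = 1..N. 1 - x * q * q ^ i)))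
      = x * c (Suc N) - c (Suc (Suc N))" .
  have "(1 - x) * strange_sum q (Suc N) x
        + q\<^sup>2 * x ^ 3 * ((1 - x * q) * strange_sum q (Suc N) (x * q))
      = ((1 - x) * strange_sum q N x + q\<^sup>2 * x ^ 3 * ((1 - x * q) * strange_sum q N (x * q)))
        + (1 - x) * c N
        + q\<^sup>2 * x ^ 3 * ((1 - x * q) * ((x * q) ^ N * (\<Prod>i = 1..N. 1 - x * q * q ^ i)))"
    by (simp add: strange_sum_def c_def distrib_left)
  also have "\<dots> = 1 - q * x\<^sup>2 - (1 - x) * c (Suc N) - c (Suc (Suc N))"
    unfolding Suc.IH step by (simp add: algebra_simps)
  finally show ?case .
qed

lemma pent_Suc: "pent (int (Suc a)) = pent (int a) + 3 * a + 2"
  using two_pent[of "int (Suc a)"] two_pent[of "int a"] by (simp add: algebra_simps)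

lemma pent_neg_Suc: "pent (- int (Suc a)) = pent (int a) + 2 * a + 1"
  using two_pent[of "- int (Suc a)"] two_pent[of "int a"] by (simp add: algebra_simps)

text \<open>
  At \<open>x = q\<^sup>a\<close> the functional equation is a first order recursion in \<open>a\<close> for
  \<open>(1 - q\<^sup>a) strange_sum q N (q\<^sup>a)\<close>, and the factor \<open>1 - q\<^sup>a\<close> gives it the initial value 0.
  The integrating factor \<open>(-1)\<^sup>a q\<close> to the power \<open>pent a\<close> makes it a plain summation, whose terms
  are those of Euler's pentagonal number theorem; the step from \<open>a\<close> to \<open>a + 1\<close> adds the two indices
  \<open>-(a + 1)\<close> and \<open>a\<close>. The divisor \<open>d\<close> absorbs the truncation terms and is chosen later.
\<close>
lemma strange_sum_partial_theta:
  fixes q d :: "'a::comm_ring_1"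
  assumes d: "\<And>a. d dvd (\<Prod>i = 1..N. 1 - q ^ (a + i))"
  shows "d dvd (1 - q ^ a) * ((- 1) ^ a * q ^ pent (int a) * strange_sum q N (q ^ a))
           + (\<Sum>b\<in>{- int a..<int a}. (- 1) ^ nat \<bar>b\<bar> * q ^ pent b)"
    (is "d dvd ?L a")
proof (induction a)
  case 0
  show ?case by simp
next
  case (Suc a)
  define c where "c n = (q ^ a) ^ n * (\<Prod>i = 1..n. 1 - q ^ a * q ^ i)" for n
  have dc: "d dvd c N" "d dvd c (Suc N)"
    using d[of a] by (simp_all add: c_def power_add)
  have fe: "(1 - q ^ a) * strange_sum q N (q ^ a)
      + q ^ (3 * a + 2) * ((1 - q ^ Suc a) * strange_sum q N (q ^ Suc a))
      = 1 - q ^ (2 * a + 1) - (1 - q ^ a) * c N - c (Suc N)"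
    using strange_sum_functional_equation[of "q ^ a" q N]
    by (simp add: c_def algebra_simps flip: power_mult power_add power_Suc)
  have ivl: "{- int (Suc a)..<int (Suc a)} = insert (- int (Suc a)) (insert (int a) {- int a..<int a})"
    by auto
  have "(\<Sum>b\<in>{- int (Suc a)..<int (Suc a)}. (- 1) ^ nat \<bar>b\<bar> * q ^ pent b)
      = (\<Sum>b\<in>{- int a..<int a}. (- 1) ^ nat \<bar>b\<bar> * q ^ pent b)
        + (- 1) ^ a * q ^ pent (int a) * (1 - q ^ (2 * a + 1))"
    unfolding ivl by (simp add: pent_neg_Suc[simplified] nat_add_distrib algebra_simps power_add)
  then have "?L (Suc a) = ?L a - (- 1) ^ a * q ^ pent (int a) *
      ((1 - q ^ a) * strange_sum q N (q ^ a)
      + q ^ (3 * a + 2) * ((1 - q ^ Suc a) * strange_sum q N (q ^ Suc a)) - (1 - q ^ (2 * a + 1)))"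
    unfolding pent_Suc by (simp add: algebra_simps power_add)
  also have "\<dots> = ?L a + (- 1) ^ a * q ^ pent (int a) * ((1 - q ^ a) * c N + c (Suc N))"
    unfolding fe by (simp add: algebra_simps)
  finally show ?case
    using Suc.IH dc by (simp only: dvd_add dvd_mult)
qed

section \<open>Dissection of polynomials\<close>

text \<open>
  The \<open>i\<close>-th component of the \<open>p\<close>-dissection. For \<open>p > 0\<close> the coefficients
  with \<open>m\<close> beyond the degree of \<open>f\<close> vanish, so that the sum captures all of them.
\<close>
definition section_poly :: "nat \<Rightarrow> nat \<Rightarrow> int poly \<Rightarrow> int poly" where
  "section_poly p i f = (\<Sum>m\<le>Polynomial.degree f. Polynomial.monom (Polynomial.coeff f (p * m + i)) m)"

abbreviation (input) qvar :: "int poly" where "qvar \<equiv> Polynomial.monom 1 1"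

lemma coeff_section_poly:
  assumes "p > 0"
  shows "Polynomial.coeff (section_poly p i f) m = Polynomial.coeff f (p * m + i)"
proof -
  have "Polynomial.coeff f (p * m + i) = 0" if "m > Polynomial.degree f"
  proof -
    have "p * m \<ge> m" using assms by simp
    then show ?thesis using that by (intro Polynomial.coeff_eq_0) linarith
  qed
  then show ?thesis by (auto simp: section_poly_def Polynomial.coeff_sum not_le)
qed

lemma section_poly_add:
  "p > 0 \<Longrightarrow> section_poly p i (f + g) = section_poly p i f + section_poly p i g"
  by (rule poly_eqI) (simp add: coeff_section_poly)

lemma section_poly_diff:
  "p > 0 \<Longrightarrow> section_poly p i (f - g) = section_poly p i f - section_poly p i g"
  by (rule poly_eqI) (simp add: coeff_section_poly)

lemma section_poly_sum:
  "p > 0 \<Longrightarrow> section_poly p i (\<Sum>a\<in>A. f a) = (\<Sum>a\<in>A. section_poly p i (f a))"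
  by (rule poly_eqI) (simp add: coeff_section_poly Polynomial.coeff_sum)

lemma section_poly_sign:
  "p > 0 \<Longrightarrow> section_poly p i ((- 1) ^ k * f) = (- 1) ^ k * section_poly p i f"
  by (rule poly_eqI) (cases "even k"; simp add: coeff_section_poly)

lemma qvar_power: "qvar ^ k = Polynomial.monom 1 k"
  by (simp add: Polynomial.monom_power)

text \<open>
  Taking a component of the dissection is linear over the polynomials in \<open>q\<^sup>p\<close>, with \<open>q\<^sup>p\<close> acting
  as the new variable.
\<close>
lemma section_poly_qvar_mult:
  assumes "i < p"
  shows "section_poly p i (qvar ^ (p * k) * f) = qvar ^ k * section_poly p i f"
proof (rule poly_eqI)
  fix m
  have "p * k \<le> p * m + i \<longleftrightarrow> k \<le> m"
  proof
    assume "p * k \<le> p * m + i"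
    also have "\<dots> < p * Suc m" using assms by simp
    finally show "k \<le> m" by (simp only: mult_less_cancel1 less_Suc_eq_le)
  next
    assume "k \<le> m"
    then show "p * k \<le> p * m + i" by (simp add: trans_le_add1)
  qed
  moreover have "p * m + i - p * k = p * (m - k) + i" if "k \<le> m"
    using that by (simp add: diff_mult_distrib2 mult_le_mono2)
  ultimately show "Polynomial.coeff (section_poly p i (qvar ^ (p * k) * f)) m
      = Polynomial.coeff (qvar ^ k * section_poly p i f) m"
    using assms unfolding qvar_power by (auto simp: coeff_section_poly Polynomial.coeff_monom_mult)
qed

lemma section_poly_qvar_power:
  assumes "i < p"
  shows "section_poly p i (qvar ^ e) = (if e mod p = i then qvar ^ (e div p) else 0)"
proof (rule poly_eqI)
  fix m
  have "p * m + i = e \<longleftrightarrow> e mod p = i \<and> e div p = m"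
    using assms by auto
  then show "Polynomial.coeff (section_poly p i (qvar ^ e)) m =
      Polynomial.coeff (if e mod p = i then qvar ^ (e div p) else 0) m"
    using assms unfolding qvar_power by (auto simp: coeff_section_poly Polynomial.coeff_monom)
qed

text \<open>
  By the linearity over polynomials in \<open>q\<^sup>p\<close>, vanishing to order \<open>k\<close> at all \<open>p\<close>-th roots of
  unity becomes vanishing to order \<open>k\<close> at 1.
\<close>
lemma section_poly_dvd:
  assumes "i < p" and "(1 - qvar ^ p) ^ k dvd f"
  shows "(1 - qvar) ^ k dvd section_poly p i f"
proof -
  have "section_poly p i ((1 - qvar ^ p) ^ k * g) = (1 - qvar) ^ k * section_poly p i g" for g
  proof (induction k arbitrary: g)
    case (Suc k)
    have "section_poly p i ((1 - qvar ^ p) * g) = (1 - qvar) * section_poly p i g"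
      using assms(1) section_poly_qvar_mult[OF assms(1), of 1 g]
      by (simp add: left_diff_distrib section_poly_diff)
    then show ?case using Suc.IH[of "(1 - qvar ^ p) * g"] by (simp add: mult_ac)
  qed simp
  then show ?thesis using assms(2) by (auto elim!: dvdE)
qed

text \<open>
  Any \<open>p\<close> consecutive exponents contain a multiple of \<open>p\<close>, and so each block of \<open>p\<close> factors
  contributes one factor \<open>1 - q\<^sup>p\<close>.
\<close>
lemma pow_dvd_consecutive_product:
  fixes q :: "'a::comm_ring_1"
  assumes "p > 0"
  shows "(1 - q ^ p) ^ (N div p) dvd (\<Prod>i = 1..N. 1 - q ^ (a + i))"
proof -
  have "(1 - q ^ p) ^ K dvd (\<Prod>i = 1..p * K. 1 - q ^ (a + i))" for K
  proof (induction K)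
    case (Suc K)
    have "{1..p * Suc K} = {1..p * K} \<union> {p * K + 1..p * K + p}" by auto
    then have split: "(\<Prod>i = 1..p * Suc K. 1 - q ^ (a + i)) =
        (\<Prod>i = 1..p * K. 1 - q ^ (a + i)) * (\<Prod>i = p * K + 1..p * K + p. 1 - q ^ (a + i))"
      by (simp add: prod.union_disjoint)
    \<comment> \<open>The offset that leads from \<open>a\<close> to the first multiple of \<open>p\<close> beyond \<open>a + p * K\<close>.\<close>
    define j where "j = p * ((a + p * K) div p + 1) - a"
    have "p * ((a + p * K) div p + 1) > a + p * K"
      using assms dividend_less_times_div[of p "a + p * K"] by simp
    moreover have "p * ((a + p * K) div p + 1) \<le> a + p * K + p"
      using times_div_less_eq_dividend[of p "a + p * K"] by (simp add: distrib_left)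
    ultimately have j: "j \<in> {p * K + 1..p * K + p}" "a + j = p * ((a + p * K) div p + 1)"
      unfolding j_def atLeastAtMost_iff by linarith+
    have "1 - q ^ p dvd 1 - q ^ (a + j)"
      unfolding j(2) power_mult one_diff_power_eq by (rule dvd_triv_left)
    then have "1 - q ^ p dvd (\<Prod>i = p * K + 1..p * K + p. 1 - q ^ (a + i))"
      using j(1) by (meson dvd_prodI dvd_trans finite_atLeastAtMost)
    with Suc.IH show ?case unfolding split power_Suc2 by (rule mult_dvd_mono)
  qed simp
  moreover have "(\<Prod>i = 1..p * (N div p). 1 - q ^ (a + i)) dvd (\<Prod>i = 1..N. 1 - q ^ (a + i))"
    by (rule prod_dvd_prod_subset) auto
  ultimately show ?thesis by (meson dvd_trans)
qed

section \<open>Congruences modulo powers of 1 - q\<close>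

text \<open>
  The order of vanishing at 1 is additive, and it is 0 for \<open>c\<close>.
\<close>
lemma one_minus_qvar_power_dvd_cancel:
  fixes c z :: "int poly"
  assumes "poly c 1 \<noteq> 0" and "(1 - qvar) ^ K dvd c * z"
  shows "(1 - qvar) ^ K dvd z"
proof -
  have neg: "1 - qvar = - [:- 1, 1:]"
    by (simp add: Polynomial.monom_altdef one_pCons)
  have dvd: "(1 - qvar) ^ K dvd f \<longleftrightarrow> f = 0 \<or> K \<le> Polynomial.order 1 f" for f
    unfolding neg power_minus[of "[:- 1, 1:]"] order_divides[symmetric]
    by (cases "even K") simp_all
  have "c \<noteq> 0" using assms(1) by auto
  have "Polynomial.order 1 c = 0"
    using assms(1) by (simp add: order_root)
  then show ?thesis
    using assms(2) order_mult[of c z 1] \<open>c \<noteq> 0\<close> unfolding dvd by (cases "z = 0") auto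
qed

text \<open>
  The alternating sum of the values \<open>poly B (Q\<^sup>m)\<close> against the binomial coefficients
  \<open>K choose m\<close>, that is the \<open>K\<close>-th finite difference in \<open>m\<close>, replaces each monomial \<open>x\<^sup>j\<close> of
  \<open>B\<close> by \<open>(1 - Q\<^sup>j)\<^sup>K\<close> and is therefore divisible by \<open>(1 - Q)\<^sup>K\<close>. All its terms except the one
  for \<open>m = 0\<close> are so by assumption.
\<close>
lemma dvd_poly_power_extrapolate:
  fixes B :: "'a::comm_ring_1 poly"
  assumes "\<And>m. 1 \<le> m \<Longrightarrow> m \<le> K \<Longrightarrow> (1 - Q) ^ K dvd poly B (Q ^ m)"
  shows "(1 - Q) ^ K dvd poly B 1"
proof -
  define f where "f m = (- 1) ^ m * of_nat (K choose m) * poly B (Q ^ m)" for m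
  have "(\<Sum>m\<le>K. f m) = (\<Sum>j\<le>Polynomial.degree B. Polynomial.coeff B j *
      (\<Sum>m\<le>K. of_nat (K choose m) * (- (Q ^ j)) ^ m * 1 ^ (K - m)))"
    unfolding f_def poly_altdef sum_distrib_left
    by (subst sum.swap) (simp add: mult_ac power_minus[of "Q ^ _"] flip: power_mult)
  also have "\<dots> = (\<Sum>j\<le>Polynomial.degree B. Polynomial.coeff B j * (1 - Q ^ j) ^ K)"
    unfolding binomial_ring[symmetric] by simp
  finally have "(1 - Q) ^ K dvd (\<Sum>m\<le>K. f m)"
    by (simp add: one_diff_power_eq power_mult_distrib dvd_sum)
  moreover have "(\<Sum>m\<le>K. f m) = poly B 1 + (\<Sum>m = 1..K. f m)"
    by (simp add: f_def sum.atLeast1_atMost_eq sum.atMost_shift)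
  moreover have "(1 - Q) ^ K dvd (\<Sum>m = 1..K. f m)"
    unfolding f_def using assms by (intro dvd_sum dvd_mult) auto
  ultimately show ?thesis
    using dvd_add_left_iff by metis
qed

lemma poly_strange_sum:
  "poly (strange_sum [:q:] N P) x = strange_sum q N (poly P x)"
  by (simp add: strange_sum_def poly_sum poly_prod)

text \<open>
  Polynomial dependence on \<open>q\<^sup>p\<^sup>m\<close> survives the dissection, because powers of \<open>q\<^sup>p\<close> can be pulled
  out.
\<close>
lemma section_poly_strange_sum:
  assumes "i < p"
  shows "\<exists>B. \<forall>m. section_poly p i (strange_sum qvar N (qvar ^ (p * m))) = poly B (qvar ^ m)"
proof -
  define A where "A = strange_sum [:qvar:] N [:0, 1:]"
  have "section_poly p i (strange_sum qvar N (qvar ^ (p * m)))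
    = poly (\<Sum>j\<le>Polynomial.degree A. Polynomial.monom (section_poly p i (Polynomial.coeff A j)) j) (qvar ^ m)"
    for m
  proof -
    have "strange_sum qvar N (qvar ^ (p * m)) = poly A (qvar ^ (p * m))"
      unfolding A_def poly_strange_sum by simp
    also have "\<dots> = (\<Sum>j\<le>Polynomial.degree A. qvar ^ (p * (m * j)) * Polynomial.coeff A j)"
      unfolding poly_altdef power_mult[symmetric] mult.assoc by (simp only: mult.commute)
    finally have "section_poly p i (strange_sum qvar N (qvar ^ (p * m)))
        = (\<Sum>j\<le>Polynomial.degree A. qvar ^ (m * j) * section_poly p i (Polynomial.coeff A j))"
      using assms by (simp only: section_poly_sum section_poly_qvar_mult)
    then show ?thesis
      unfolding poly_sum poly_monom power_mult by (simp only: mult.commute)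
  qed
  then show ?thesis by blast
qed

section \<open>Pentagonal numbers modulo p\<close>

lemma sign_power_nat_abs:
  "(- 1 :: 'a::ring_1) ^ nat \<bar>b\<bar> = (if even b then 1 else - 1)"
  by (simp add: minus_one_power_iff even_nat_iff)

text \<open>
  The sign \<open>e\<close> and the index \<open>b\<close> put \<open>p\<close> into the form \<open>\<bar>6 b + 1\<bar>\<close> in which it occurs among the
  square roots of the numbers \<open>24 pent b + 1\<close>.
\<close>
lemma prime_six_adjacent:
  assumes "prime p" "p \<ge> 5"
  obtains e b :: int where "e = 1 \<or> e = - 1" "e * int p = 6 * b + 1"
proof -
  have "\<not> 2 dvd p" "\<not> 3 dvd p"
    using assms primes_dvd_imp_eq[of 2 p] primes_dvd_imp_eq[of 3 p] by auto
  then have "p mod 6 = 1 \<or> p mod 6 = 5" by presburger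
  then show ?thesis
  proof
    assume "p mod 6 = 1"
    then have "1 * int p = 6 * (int p div 6) + 1" by presburger
    then show ?thesis using that by blast
  next
    assume "p mod 6 = 5"
    then have "- 1 * int p = 6 * (- (int p div 6) - 1) + 1" by presburger
    then show ?thesis using that by blast
  qed
qed

lemma pent_24: "24 * int (pent b) = (6 * b + 1)\<^sup>2 - 1"
  using two_pent[of b] by (simp add: power2_eq_square algebra_simps)

lemma pent_multiple:
  assumes e: "e = 1 \<or> e = - 1" "e * int p = 6 * b + 1"
  shows "pent (b + e * int p * c) = p\<^sup>2 * pent c + pent b"
proof -
  have "24 * int (pent (b + e * int p * c)) = ((e * int p) * (6 * c + 1))\<^sup>2 - 1"
    unfolding pent_24 e(2) by (simp add: algebra_simps)
  also have "\<dots> = (int p)\<^sup>2 * (6 * c + 1)\<^sup>2 - 1"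
    using e(1) by (auto simp: power_mult_distrib)
  also have "\<dots> = (int p)\<^sup>2 * (24 * int (pent c)) + ((e * int p)\<^sup>2 - 1)"
    unfolding pent_24 using e(1) by (auto simp: algebra_simps)
  also have "\<dots> = 24 * int (p\<^sup>2 * pent c + pent b)"
    using pent_24[of b] e(2) by (simp add: algebra_simps)
  finally show ?thesis by (simp only: mult_cancel_left of_nat_eq_iff) simp
qed

text \<open>
  Here \<open>24 pent b = p\<^sup>2 - 1\<close>, so the residue modulo \<open>p\<close> is \<open>i\<close>. Writing \<open>24 i + 1 = p s\<close>, the quotient
  \<open>d\<close> satisfies \<open>24 d + s = p\<close> with \<open>0 < s < 24\<close>, which makes it \<open>p div 24\<close>.
\<close>
lemma pent_div_mod:
  fixes p i :: nat
  assumes "prime p" "p \<ge> 5" "1 \<le> i" "i < p" "[24 * int i = - 1] (mod int p)"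
    and e: "e = 1 \<or> e = - 1" "e * int p = 6 * b + 1"
  shows "pent b = p * (p div 24) + i"
proof -
  obtain s where s: "24 * int i + 1 = int p * s"
    using assms(5) by (auto simp: cong_iff_dvd_diff dvd_def)
  have "s > 0" using s assms(1,3) by (smt (verit) zero_less_mult_pos of_nat_0_less_iff prime_gt_0_nat of_nat_0_le_iff)
  have "int p * s < int p * 24" using s assms(4) by linarith
  then have "s < 24" using mult_less_cancel_left_pos[of "int p" s 24] assms(2) by simp
  have "24 * int (pent b) = (int p)\<^sup>2 - 1"
    unfolding pent_24 e(2)[symmetric] using e(1) by auto
  then have eq: "24 * (int (pent b) - int i) = int p * (int p - s)"
    using s by (simp add: power2_eq_square algebra_simps)
  have "\<not> p dvd 2" "\<not> p dvd 3"
    using assms(2) by (auto dest: dvd_imp_le)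
  then have "\<not> p dvd 2 ^ 3 * 3"
    using assms(1) by (metis prime_dvd_mult_iff prime_dvd_power)
  then have "coprime (2 ^ 3 * 3) p"
    using assms(1) by (metis prime_imp_coprime coprime_commute)
  then have cop: "coprime 24 (int p)"
    using coprime_int_iff[of 24 p] by simp
  have "24 dvd int p - s"
    using cop coprime_dvd_mult_right_iff[of 24 "int p" "int p - s"] by (simp flip: eq)
  then obtain d where d: "int p - s = 24 * d" by (auto simp: dvd_def)
  then have "d = int (p div 24)" using \<open>s > 0\<close> \<open>s < 24\<close> by (simp add: zdiv_int)
  moreover have "int (pent b) - int i = int p * d" using eq d by simp
  ultimately have "int (pent b) = int (p * (p div 24) + i)" by simp
  then show ?thesis by (simp only: of_nat_eq_iff)
qed

text \<open>
  As 12 and 3 differ by a square, quadratic reciprocity applies with the prime 3. The reciprocal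
  symbol \<open>(p/3)\<close> is \<open>e\<close>, because \<open>p \<equiv> e (mod 3)\<close>.
\<close>
lemma Legendre_12:
  assumes "prime p" "p \<ge> 5" and e: "e = 1 \<or> e = - 1" "e * int p = 6 * b + 1"
  shows "Legendre 12 (int p) = (- 1) ^ nat \<bar>b\<bar>"
proof -
  have "\<not> p dvd 2" "\<not> p dvd 3"
    using assms(2) by (auto dest: dvd_imp_le)
  then have "\<not> p dvd 2 ^ 2 * 3"
    using assms(1) by (metis prime_dvd_mult_iff prime_dvd_power)
  then have "\<not> int p dvd 12" "\<not> int p dvd 3"
    using \<open>\<not> p dvd 3\<close> int_dvd_int_iff[of p 12] int_dvd_int_iff[of p 3] by simp_all
  moreover have "QuadRes (int p) 12 \<longleftrightarrow> QuadRes (int p) 3"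
  proof
    assume "QuadRes (int p) 3"
    then obtain y where "[y\<^sup>2 = 3] (mod int p)" unfolding QuadRes_def by blast
    then have "[2\<^sup>2 * y\<^sup>2 = 2\<^sup>2 * 3] (mod int p)" by (rule cong_scalar_left)
    then have "[(2 * y)\<^sup>2 = 12] (mod int p)" by (simp add: power_mult_distrib)
    then show "QuadRes (int p) 12" unfolding QuadRes_def by blast
  next
    assume "QuadRes (int p) 12"
    then obtain y where y: "[y\<^sup>2 = 12] (mod int p)" unfolding QuadRes_def by blast
    have "odd p" using prime_odd_nat[OF assms(1)] assms(2) by simp
    then obtain h where h: "p = 2 * h + 1" by (auto elim: oddE)
    \<comment> \<open>The inverse of 2 modulo \<open>p\<close>.\<close>
    define g where "g = int h + 1"
    have g: "2 * g = 1 + int p" using h by (simp add: g_def)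
    have "[g\<^sup>2 * y\<^sup>2 = g\<^sup>2 * 12] (mod int p)" using y by (rule cong_scalar_left)
    moreover have "g\<^sup>2 * 12 = 3 * (2 * g) * (2 * g)" by (simp add: power2_eq_square)
    moreover have "[3 * (2 * g) * (2 * g) = 3 * 1 * 1] (mod int p)"
      unfolding g by (intro cong_mult cong_refl) (simp_all add: cong_def)
    ultimately have "[(g * y)\<^sup>2 = 3] (mod int p)"
      by (metis cong_trans mult.right_neutral power_mult_distrib)
    then show "QuadRes (int p) 3" unfolding QuadRes_def by blast
  qed
  ultimately have "Legendre 12 (int p) = Legendre 3 (int p)"
    by (simp add: Legendre_def cong_0_iff)
  moreover have "Legendre 3 (int p) * Legendre (int p) 3 = (- 1) ^ ((p - 1) div 2)"
    using Quadratic_Reciprocity[of 3 p] assms(1,2) by simp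
  moreover have "Legendre (int p) 3 = e"
    using e(1)
  proof
    assume "e = 1"
    then have "[int p = 1] (mod 3)" using e(2) by (simp add: cong_iff_dvd_diff)
    moreover from this have "[1\<^sup>2 = int p] (mod 3)" by (simp add: cong_sym)
    then have "QuadRes 3 (int p)" unfolding QuadRes_def by blast
    ultimately show ?thesis using \<open>e = 1\<close>
      by (auto simp: Legendre_def cong_def)
  next
    assume "e = - 1"
    then have p2: "int p mod 3 = 2" using e(2) by presburger
    have "\<not> QuadRes 3 (int p)"
    proof
      assume "QuadRes 3 (int p)"
      then obtain y where "[y\<^sup>2 = int p] (mod 3)" unfolding QuadRes_def by blast
      then have "(y mod 3) * (y mod 3) mod 3 = 2"
        using p2 by (simp add: cong_def power2_eq_square mod_mult_eq)
      moreover have "y mod 3 = 0 \<or> y mod 3 = 1 \<or> y mod 3 = 2" by presburger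
      ultimately show False by auto
    qed
    then show ?thesis using \<open>e = - 1\<close> p2 by (simp add: Legendre_def cong_def)
  qed
  moreover have "e * (- 1) ^ ((p - 1) div 2) = (- 1) ^ nat \<bar>b\<bar>"
  proof -
    have "even ((p - 1) div 2) \<longleftrightarrow> (if e = 1 then even b else odd b)"
      using e assms(2) by auto presburger+
    then show ?thesis using e(1) by (auto simp: sign_power_nat_abs minus_one_power_iff)
  qed
  ultimately show ?thesis using e(1) by auto
qed

section \<open>The dissected sum\<close>

text \<open>
  The exponent \<open>pent b\<close> lies in the class of \<open>i\<close> exactly if \<open>p\<close> divides \<open>6 b + 1\<close>: this is the one
  residue class for which the square \<open>24 pent b + 1\<close> vanishes modulo \<open>p\<close>. Then
  \<open>6 b + 1 = e p (6 c + 1)\<close> for an integer \<open>c\<close>, and the surviving terms reproduce the whole sum with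
  \<open>q\<close> replaced by \<open>q\<close> to the power \<open>p\<^sup>2\<close>. The range \<open>-p m \<le> b < p m\<close> corresponds precisely to
  \<open>-m \<le> c < m\<close>, so that no boundary terms appear.
\<close>
lemma section_poly_partial_theta:
  fixes p i m :: nat
  assumes "prime p" "p \<ge> 5" "1 \<le> i" "i < p" "[24 * int i = - 1] (mod int p)"
  shows "section_poly p i (\<Sum>b\<in>{- int (p * m)..<int (p * m)}. (- 1) ^ nat \<bar>b\<bar> * qvar ^ pent b)
    = of_int (Legendre 12 (int p)) * qvar ^ (p div 24)
      * (\<Sum>c\<in>{- int m..<int m}. (- 1) ^ nat \<bar>c\<bar> * (qvar ^ p) ^ pent c)"
proof -
  obtain e b0 where e: "e = 1 \<or> e = - 1" "e * int p = 6 * b0 + 1"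
    using prime_six_adjacent[OF assms(1,2)] .
  have pos: "p > 0" using assms by simp
  define g where "g c = b0 + e * int p * c" for c
  define T where "T b = (- 1) ^ nat \<bar>b\<bar> * section_poly p i (qvar ^ pent b)" for b
  have pent_b0: "pent b0 = p * (p div 24) + i"
    using pent_div_mod[OF assms e] .
  have pent_g: "pent (g c) = p * (p div 24 + p * pent c) + i" for c
    unfolding g_def pent_multiple[OF e] pent_b0 by (simp add: power2_eq_square algebra_simps)
  have range_g: "g c \<in> {- int (p * m)..<int (p * m)} \<longleftrightarrow> c \<in> {- int m..<int m}" for c
  proof -
    have le: "int p * x \<le> int p * y + r \<longleftrightarrow> x \<le> y"
      and less: "int p * x < int p * y + r \<longleftrightarrow> x \<le> y"
      if "0 < r" "r < int p" for x y r
    proof -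
      have "int p * x < int p * y + r" if "x \<le> y"
      proof -
        have "int p * x \<le> int p * y" using that by (intro mult_left_mono) auto
        then show ?thesis using \<open>0 < r\<close> by linarith
      qed
      moreover have "x \<le> y" if "int p * x \<le> int p * y + r"
      proof -
        have "int p * x < int p * (y + 1)" using that \<open>r < int p\<close> by (simp add: distrib_left)
        then show ?thesis using pos by simp
      qed
      ultimately show "int p * x \<le> int p * y + r \<longleftrightarrow> x \<le> y"
        "int p * x < int p * y + r \<longleftrightarrow> x \<le> y" by auto
    qed
    from e(1) show ?thesis
    proof
      assume [simp]: "e = 1"
      then have "0 < b0" "b0 < int p" using e(2) assms(2) by auto
      then show ?thesis
        using le[of b0 "- int m" c] le[of b0 "int m" c] by (auto simp: g_def)
    next
      assume [simp]: "e = - 1"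
      then have "0 < - b0" "- b0 < int p" using e(2) assms(2) by auto
      then show ?thesis
        using less[of "- b0" "- int m" c] less[of "- b0" "int m" c] by (auto simp: g_def)
    qed
  qed
  have inj: "inj_on g {- int m..<int m}"
    using pos e(1) by (auto simp: inj_on_def g_def)
  have T_0: "T b = 0" if "b \<in> {- int (p * m)..<int (p * m)} - g ` {- int m..<int m}" for b
  proof (rule ccontr)
    assume "T b \<noteq> 0"
    then have "pent b mod p = i"
      unfolding T_def section_poly_qvar_power[OF assms(4)] by (auto split: if_splits)
    moreover have "pent b0 mod p = i" using assms(4) by (simp add: pent_b0)
    ultimately have "[int (pent b) = int (pent b0)] (mod int p)"
      by (simp add: cong_def flip: zmod_int)
    then have "[24 * int (pent b) = 24 * int (pent b0)] (mod int p)" by (rule cong_scalar_left)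
    then have "int p dvd (6 * b + 1)\<^sup>2 - (6 * b0 + 1)\<^sup>2"
      unfolding pent_24 by (simp add: cong_iff_dvd_diff)
    moreover have "int p dvd (6 * b0 + 1)\<^sup>2" unfolding e(2)[symmetric] power_mult_distrib by simp
    ultimately have "int p dvd (6 * b + 1)\<^sup>2"
      by (metis diff_add_cancel dvd_add)
    then have "int p dvd 6 * b + 1"
      using assms(1) by (simp add: prime_dvd_power_iff)
    then have "int p dvd (6 * b + 1) - (6 * b0 + 1)"
      unfolding e(2)[symmetric] by simp
    then have "int p dvd 6 * (b - b0)" by (simp add: algebra_simps)
    moreover have "\<not> int p dvd 6"
    proof -
      have "\<not> p dvd 2" "\<not> p dvd 3" using assms(2) by (auto dest: dvd_imp_le)
      then have "\<not> p dvd 2 * 3" using assms(1) by (metis prime_dvd_mult_iff)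
      then show ?thesis using int_dvd_int_iff[of p 6] by simp
    qed
    moreover have "prime (int p)" using assms(1) by simp
    ultimately have "int p dvd b - b0"
      by (simp only: prime_dvd_mult_iff) simp
    then obtain c where "b - b0 = int p * c" by (auto simp: dvd_def)
    then have "b = g (e * c)" using e(1) by (auto simp: g_def)
    then show False using that range_g[of "e * c"] by auto
  qed
  have T_g: "T (g c) = of_int (Legendre 12 (int p)) * qvar ^ (p div 24)
      * ((- 1) ^ nat \<bar>c\<bar> * (qvar ^ p) ^ pent c)" for c
  proof -
    have "odd p" using prime_odd_nat[OF assms(1)] assms(2) by simp
    then have "even (g c) \<longleftrightarrow> (even b0 \<longleftrightarrow> even c)" using e(1) by (auto simp: g_def)
    then have sign: "(- 1) ^ nat \<bar>g c\<bar> = of_int (Legendre 12 (int p)) * (- 1 :: int poly) ^ nat \<bar>c\<bar>"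
      unfolding Legendre_12[OF assms(1,2) e] sign_power_nat_abs by auto
    have "section_poly p i (qvar ^ pent (g c)) = qvar ^ (p div 24) * (qvar ^ p) ^ pent c"
      unfolding section_poly_qvar_power[OF assms(4)] pent_g power_mult[symmetric] power_add[symmetric]
      using assms(4) by simp
    then show ?thesis unfolding T_def sign by (simp only: mult_ac)
  qed
  have "section_poly p i (\<Sum>b\<in>{- int (p * m)..<int (p * m)}. (- 1) ^ nat \<bar>b\<bar> * qvar ^ pent b)
      = (\<Sum>b\<in>{- int (p * m)..<int (p * m)}. T b)"
    unfolding T_def section_poly_sum[OF pos] section_poly_sign[OF pos] ..
  also have "\<dots> = (\<Sum>b\<in>g ` {- int m..<int m}. T b)"
    using range_g T_0 by (intro sum.mono_neutral_right) auto
  also have "\<dots> = (\<Sum>c\<in>{- int m..<int m}. T (g c))"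
    using inj by (simp add: sum.reindex)
  finally show ?thesis unfolding T_g sum_distrib_left .
qed

text \<open>
  The partial theta formula is used twice: at \<open>a = p m\<close> before the dissection, and at \<open>a = m\<close>
  with \<open>q\<^sup>p\<close> in place of \<open>q\<close> for the variable after it. By the preceding lemma the two theta sums
  agree up to the factor \<open>(12/p) q\<close> to the power \<open>p div 24\<close>, and so they cancel.
\<close>
lemma section_poly_strange_sum_dvd:
  fixes p i m K :: nat
  assumes "prime p" "p \<ge> 5" "1 \<le> i" "i < p" "[24 * int i = - 1] (mod int p)"
  shows "(1 - qvar) ^ K dvd (1 - qvar ^ m) * section_poly p i (strange_sum qvar (p * K) (qvar ^ (p * m)))
    - of_int (Legendre 12 (int p)) * qvar ^ (p div 24) * (qvar ^ m) ^ ((p - 1) div 2)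
      * ((1 - qvar ^ (p * m)) * strange_sum (qvar ^ p) (p * K) (qvar ^ (p * m)))"
    (is "_ dvd (1 - _) * section_poly p i ?G - ?C * _ * (_ * ?H)")
proof -
  define S where "S = (\<Sum>c\<in>{- int m..<int m}. (- 1) ^ nat \<bar>c\<bar> * (qvar ^ p) ^ pent c)"
  have pos: "p > 0" using assms by simp
  have "odd p" using prime_odd_nat[OF assms(1)] assms(2) by simp
  then obtain h where h: "p = 2 * h + 1" by (auto elim: oddE)
  then have half: "(p - 1) div 2 = h" by simp
  have "pent (int (p * m)) + p * (m * h) = p * (p * pent (int m))"
  proof -
    have "2 * int (pent (int (p * m)) + p * (m * h))
        = int (p * m) * (3 * int (p * m) + 1) + 2 * int (p * (m * h))"
      using two_pent[of "int (p * m)"] by (simp only: of_nat_add distrib_left)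
    also have "\<dots> = int p * (int p * (int m * (3 * int m + 1)))"
      by (simp add: h algebra_simps)
    also have "\<dots> = 2 * int (p * (p * pent (int m)))"
      by (simp flip: two_pent)
    finally show ?thesis by (simp only: mult_cancel_left of_nat_eq_iff) simp
  qed
  moreover from this have "p dvd pent (int (p * m))"
    by (metis dvd_add_left_iff dvd_triv_left)
  then obtain t where t: "pent (int (p * m)) = p * t" by (auto simp: dvd_def)
  ultimately have "p * (t + m * h) = p * (p * pent (int m))" by (simp add: distrib_left)
  then have exps: "p * pent (int m) = t + m * h" using pos by simp
  define s where "s = (- 1 :: int poly) ^ m"
  have sign: "(- 1 :: int poly) ^ (p * m) = s"
    using \<open>odd p\<close> by (simp add: s_def power_mult)

  \<comment> \<open>The formula at \<open>a = p m\<close>, followed by the dissection.\<close>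
  have "(1 - qvar ^ p) ^ K dvd (1 - qvar ^ (p * m)) * ((- 1) ^ (p * m) * qvar ^ pent (int (p * m)) * ?G)
      + (\<Sum>b\<in>{- int (p * m)..<int (p * m)}. (- 1) ^ nat \<bar>b\<bar> * qvar ^ pent b)"
    (is "_ dvd ?lhs")
    using pow_dvd_consecutive_product[OF pos, of qvar "p * K"] pos
    by (intro strange_sum_partial_theta) simp
  then have "(1 - qvar) ^ K dvd section_poly p i ?lhs"
    by (rule section_poly_dvd[OF assms(4)])
  moreover have eq: "(1 - qvar ^ (p * m)) * ((- 1) ^ (p * m) * qvar ^ pent (int (p * m)) * ?G)
     = (- 1) ^ (p * m) * (qvar ^ (p * t) * ?G - qvar ^ (p * (t + m)) * ?G)"
    unfolding t by (simp add: algebra_simps power_add)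
  have "section_poly p i ((- 1) ^ (p * m) * (qvar ^ (p * t) * ?G - qvar ^ (p * (t + m)) * ?G))
      = s * (qvar ^ t * section_poly p i ?G - qvar ^ (t + m) * section_poly p i ?G)"
    unfolding section_poly_sign[OF pos] section_poly_diff[OF pos] section_poly_qvar_mult[OF assms(4)]
    unfolding sign ..
  then have "section_poly p i ?lhs = s * (qvar ^ t * (1 - qvar ^ m) * section_poly p i ?G) + ?C * S"
    unfolding eq section_poly_add[OF pos] section_poly_partial_theta[OF assms] S_def
    by (simp only: algebra_simps power_add mult_1_right)
  ultimately have 1: "(1 - qvar) ^ K dvd s * (qvar ^ t * (1 - qvar ^ m) * section_poly p i ?G) + ?C * S"
    by simp

  \<comment> \<open>The formula at \<open>a = m\<close> with base \<open>q\<^sup>p\<close>.\<close>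
  have "(1 - qvar) ^ (p * K) dvd (1 - qvar ^ p) ^ (p * K)"
    unfolding one_diff_power_eq[of _ p] power_mult_distrib by (rule dvd_triv_left)
  then have "(1 - qvar) ^ K dvd (1 - qvar ^ p) ^ (p * K)"
    using pos le_imp_power_dvd[of K "p * K" "1 - qvar"] by (auto intro: dvd_trans)
  then have "(1 - qvar) ^ K dvd (1 - (qvar ^ p) ^ m) * ((- 1) ^ m * (qvar ^ p) ^ pent (int m) * strange_sum (qvar ^ p) (p * K) ((qvar ^ p) ^ m)) + S"
    unfolding S_def
    using pow_dvd_consecutive_product[of 1 "qvar ^ p" "p * K"]
    by (intro strange_sum_partial_theta) (simp, meson dvd_trans)
  moreover have "(qvar ^ p) ^ pent (int m) = qvar ^ t * (qvar ^ m) ^ ((p - 1) div 2)"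
    unfolding half power_mult[symmetric] exps power_add ..
  ultimately have 2: "(1 - qvar) ^ K dvd (1 - qvar ^ (p * m)) * (s * (qvar ^ t * (qvar ^ m) ^ ((p - 1) div 2)) * ?H) + S"
    by (simp add: s_def power_mult)

  have "(1 - qvar) ^ K dvd s * (qvar ^ t * (1 - qvar ^ m) * section_poly p i ?G) + ?C * S
      - ?C * ((1 - qvar ^ (p * m)) * (s * (qvar ^ t * (qvar ^ m) ^ ((p - 1) div 2)) * ?H) + S)"
    by (intro dvd_diff dvd_mult 1 2)
  also have "s * (qvar ^ t * (1 - qvar ^ m) * section_poly p i ?G) + ?C * S
      - ?C * ((1 - qvar ^ (p * m)) * (s * (qvar ^ t * (qvar ^ m) ^ ((p - 1) div 2)) * ?H) + S)
    = s * qvar ^ t * ((1 - qvar ^ m) * section_poly p i ?G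
      - ?C * (qvar ^ m) ^ ((p - 1) div 2) * ((1 - qvar ^ (p * m)) * ?H))"
    by (simp only: algebra_simps)
  finally show ?thesis
    by (rule one_minus_qvar_power_dvd_cancel[rotated]) (simp add: s_def Polynomial.poly_monom)
qed

lemma strange_sum_power_is_poly:
  "\<exists>B. \<forall>m. strange_sum q N (Q ^ (p * m)) = poly B (Q ^ m)"
proof -
  have "strange_sum q N (Q ^ (p * m)) = poly (strange_sum [:q:] N (Polynomial.monom 1 p)) (Q ^ m)" for m
    by (simp add: poly_strange_sum Polynomial.poly_monom mult.commute flip: power_mult)
  then show ?thesis by blast
qed

text \<open>
  For \<open>m \<ge> 1\<close> the factor \<open>1 - q\<^sup>m\<close> can be cancelled in the preceding congruence at the cost of one
  power of \<open>1 - q\<close>; hence the truncation after \<open>p (n + 1)\<close> terms. On the other side it leaves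
  \<open>(1 - q\<^sup>p\<^sup>m) / (1 - q\<^sup>m)\<close>. As both sides are polynomials in \<open>q\<^sup>m\<close>, the congruence extends to
  \<open>m = 0\<close>, where this quotient takes the value \<open>p\<close>.
\<close>
lemma section_poly_strange_sum_cong:
  fixes p i n :: nat
  assumes "prime p" "p \<ge> 5" "1 \<le> i" "i < p" "[24 * int i = - 1] (mod int p)"
  shows "(1 - qvar) ^ n dvd section_poly p i (strange_sum qvar (p * Suc n) 1)
    - of_nat p * (of_int (Legendre 12 (int p)) * qvar ^ (p div 24)) * strange_sum (qvar ^ p) (p * Suc n) 1"
proof -
  define C where "C = of_int (Legendre 12 (int p)) * qvar ^ (p div 24)"
  obtain G where G: "\<And>m. section_poly p i (strange_sum qvar (p * Suc n) (qvar ^ (p * m))) = poly G (qvar ^ m)"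
    using section_poly_strange_sum[OF assms(4)] by blast
  obtain H where H: "\<And>m. strange_sum (qvar ^ p) (p * Suc n) (qvar ^ (p * m)) = poly H (qvar ^ m)"
    using strange_sum_power_is_poly by blast
  define B where "B = G - [:C:] * (Polynomial.monom 1 ((p - 1) div 2)
      * ((\<Sum>j<p. Polynomial.monom 1 j) * H))"
  have poly_B: "poly B x = poly G x - C * (x ^ ((p - 1) div 2) * ((\<Sum>j<p. x ^ j) * poly H x))" for x
    by (simp add: B_def poly_sum Polynomial.poly_monom)
  have "poly (1 - qvar) 0 \<noteq> 0" by (simp add: Polynomial.poly_monom)
  then have nz: "1 - qvar \<noteq> 0" by (metis poly_0)
  have "(1 - qvar) ^ n dvd poly B (qvar ^ m)" if "1 \<le> m" for m
  proof -
    have "(1 - qvar) ^ Suc n dvd (1 - qvar ^ m) * poly G (qvar ^ m)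
       - C * (qvar ^ m) ^ ((p - 1) div 2) * ((1 - (qvar ^ m) ^ p) * poly H (qvar ^ m))"
      using section_poly_strange_sum_dvd[OF assms, of "Suc n" m]
      unfolding C_def G H by (simp only: mult.commute[of p m] power_mult)
    also have "\<dots> = (1 - qvar ^ m) * poly B (qvar ^ m)"
      unfolding one_diff_power_eq[of "qvar ^ m" p] poly_B by (simp only: algebra_simps)
    also have "\<dots> = (1 - qvar) * ((\<Sum>j<m. qvar ^ j) * poly B (qvar ^ m))"
      unfolding one_diff_power_eq[of qvar m] by (simp only: mult.assoc)
    finally have "(1 - qvar) ^ n dvd (\<Sum>j<m. qvar ^ j) * poly B (qvar ^ m)"
      unfolding power_Suc dvd_mult_cancel_left using nz by blast
    then show ?thesis
      by (rule one_minus_qvar_power_dvd_cancel[rotated]) (use that in \<open>simp add: poly_sum Polynomial.poly_monom\<close>)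
  qed
  then have "(1 - qvar) ^ n dvd poly B 1"
    by (rule dvd_poly_power_extrapolate)
  then show ?thesis
    using G[of 0] H[of 0] by (simp add: poly_B C_def mult_ac)
qed

lemma strange_sum_1: "strange_sum q N 1 = (\<Sum>n<N. qpoch q n)"
  by (simp add: strange_sum_def qpoch_def)

text \<open>
  Cutting the sum off at \<open>p n\<close> instead of \<open>p (n + 1)\<close> changes nothing modulo \<open>(1 - q)\<^sup>n\<close>, because
  the omitted terms are divisible by \<open>(1 - q\<^sup>p)\<^sup>n\<close> before the dissection.
\<close>
lemma A_poly_cong:
  fixes p i n :: nat
  assumes "prime p" "p \<ge> 5" "1 \<le> i" "i < p" "[24 * int i = - 1] (mod int p)" "n \<ge> 1"
  shows "(1 - qvar) ^ n dvd A_poly p (p * n - 1) i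
    - of_nat p * (of_int (Legendre 12 (int p)) * qvar ^ (p div 24)) * (\<Sum>j<p * Suc n. qpoch (qvar ^ p) j)"
proof -
  have pos: "p > 0" using assms by simp
  have A: "A_poly p (p * n - 1) i = section_poly p i (F_trunc (p * n - 1))"
    using assms(4) by (intro poly_eqI) (simp add: coeff_A_poly coeff_section_poly)
  have "p * n > 0" using pos assms(6) by simp
  then have "{0..p * n - 1} = {..<p * n}"
    by (simp add: atLeast0AtMost flip: lessThan_Suc_atMost)
  then have F: "F_trunc (p * n - 1) = strange_sum qvar (p * n) 1"
    unfolding F_trunc_def strange_sum_1 by simp
  have "strange_sum qvar (p * Suc n) 1 = F_trunc (p * n - 1) + (\<Sum>j = p * n..<p * Suc n. qpoch qvar j)"
    unfolding F strange_sum_1 by (simp add: lessThan_atLeast0 sum.atLeastLessThan_concat)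
  moreover have "(1 - qvar ^ p) ^ n dvd (\<Sum>j = p * n..<p * Suc n. qpoch qvar j)"
  proof (rule dvd_sum)
    fix j assume "j \<in> {p * n..<p * Suc n}"
    then have "n \<le> j div p" using pos by (simp add: less_eq_div_iff_mult_less_eq mult.commute)
    then have "(1 - qvar ^ p) ^ n dvd (1 - qvar ^ p) ^ (j div p)" by (rule le_imp_power_dvd)
    also have "\<dots> dvd qpoch qvar j"
      using pow_dvd_consecutive_product[OF pos, of qvar j 0] by (simp add: qpoch_def)
    finally show "(1 - qvar ^ p) ^ n dvd qpoch qvar j" .
  qed
  ultimately have "(1 - qvar) ^ n dvd section_poly p i (strange_sum qvar (p * Suc n) 1)
      - section_poly p i (F_trunc (p * n - 1))"
    using section_poly_dvd[OF assms(4)] by (simp only: section_poly_add[OF pos] add_diff_cancel_left')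
  from dvd_diff[OF section_poly_strange_sum_cong[OF assms(1-5), of n] this]
  show ?thesis unfolding A strange_sum_1 by (simp add: algebra_simps)
qed

section \<open>Coefficients of the expansion at q = 1\<close>

definition expand_at_one :: "int poly \<Rightarrow> int fps" where
  "expand_at_one f = fps_of_poly (pcompose f [:1, - 1:])"

lemma expand_at_one_mult: "expand_at_one (f * g) = expand_at_one f * expand_at_one g"
  by (simp add: expand_at_one_def pcompose_mult fps_of_poly_mult)

lemma expand_at_one_power: "expand_at_one (f ^ k) = expand_at_one f ^ k"
  by (induction k) (simp_all add: expand_at_one_mult, simp add: expand_at_one_def pcompose_1)

lemma expand_at_one_diff: "expand_at_one (f - g) = expand_at_one f - expand_at_one g"
  by (simp add: expand_at_one_def pcompose_diff fps_of_poly_diff)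

lemma expand_at_one_of_int: "expand_at_one (of_int c) = of_int c"
  using fps_of_int[of c, where ?'a = int]
  by (simp add: expand_at_one_def of_int_poly fps_of_poly_const)

lemma expand_at_one_qvar: "expand_at_one qvar = 1 - fps_X"
proof -
  have "pcompose qvar [:1, - 1:] = 1 - [:0, 1:]"
    by (simp add: Polynomial.monom_altdef pcompose_pCons one_pCons)
  then show ?thesis by (simp add: expand_at_one_def fps_of_poly_diff)
qed

lemma expand_at_one_sum_qpoch:
  "expand_at_one (\<Sum>j\<in>J. qpoch f j) = (\<Sum>j\<in>J. qpoch (expand_at_one f) j)"
proof -
  have factor: "expand_at_one (1 - f ^ i) = 1 - expand_at_one f ^ i" for i
    using expand_at_one_of_int[of 1] by (simp add: expand_at_one_diff expand_at_one_power)
  have "expand_at_one (\<Prod>i = 1..j. 1 - f ^ i) = (\<Prod>i = 1..j. expand_at_one (1 - f ^ i))" for j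
    by (simp only: expand_at_one_def pcompose_prod fps_of_poly_prod)
  then have "expand_at_one (qpoch f j) = qpoch (expand_at_one f) j" for j
    by (simp only: qpoch_def factor)
  then show ?thesis
    by (simp add: expand_at_one_def pcompose_sum fps_of_poly_sum)
qed

lemma nth_expand_at_one_eq:
  assumes "(1 - qvar) ^ n dvd f - g" and "k < n"
  shows "fps_nth (expand_at_one f) k = fps_nth (expand_at_one g) k"
proof -
  obtain h where "f - g = (1 - qvar) ^ n * h" using assms(1) by (auto simp: dvd_def)
  then have "expand_at_one f - expand_at_one g = expand_at_one ((1 - qvar) ^ n * h)"
    by (simp flip: expand_at_one_diff)
  also have "\<dots> = fps_X ^ n * expand_at_one h"
    using expand_at_one_of_int[of 1]
    by (simp only: expand_at_one_mult expand_at_one_power expand_at_one_diff expand_at_one_qvar) simp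
  finally have "fps_nth (expand_at_one f - expand_at_one g) k = 0"
    using assms(2) by (simp add: fps_X_power_mult_nth)
  then show ?thesis by simp
qed

theorem theorem1p12:
  fixes p i\<^sub>0 n k :: nat
  assumes "prime p" and "p \<ge> 5"
    and "1 \<le> i\<^sub>0" and "i\<^sub>0 \<le> p - 1" and "[24 * int i\<^sub>0 = - 1] (mod int p)"
    and "n \<ge> 1" and "k \<le> n - 1"
  shows "alpha p n i\<^sub>0 k = int p * Kronecker_symbol 12 (int p) * xi_bar p k"
proof -
  define f :: "int fps" where "f = (1 - fps_X) ^ p"
  have f0: "fps_nth f 0 = 1" by (simp add: f_def fps_power_zeroth)
  have i_less: "i\<^sub>0 < p" and k_less: "k < n" using assms by auto
  have F: "fps_nth (\<Sum>j<p * Suc n. qpoch f j) l = fps_nth (F_fps f) l" if "l \<le> k" for l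
  proof -
    have "n \<le> p * Suc n" using assms(2) by (simp add: trans_le_add2)
    then have "{..l} \<subseteq> {..<p * Suc n}" using that k_less by auto
    then show ?thesis
      unfolding fps_nth_F_fps[OF f0] fps_sum_nth
      by (intro sum.mono_neutral_right) (auto simp: qpoch_fps_nth_eq_0[OF f0] not_le)
  qed
  have "fps_nth ((1 - fps_X) ^ (p div 24) * (\<Sum>j<p * Suc n. qpoch f j)) k = xi_bar p k"
    unfolding xi_bar_def f_def[symmetric] fps_mult_nth by (intro sum.cong) (simp_all only: F diff_le_self)
  moreover have "alpha p n i\<^sub>0 k = fps_nth (of_int (int p * Legendre 12 (int p))
      * ((1 - fps_X) ^ (p div 24) * (\<Sum>j<p * Suc n. qpoch f j))) k"
  proof -
    have "alpha p n i\<^sub>0 k = fps_nth (expand_at_one (A_poly p (p * n - 1) i\<^sub>0)) k"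
      by (simp add: alpha_def expand_at_one_def)
    also have "\<dots> = fps_nth (expand_at_one (of_int (int p * Legendre 12 (int p))
        * (qvar ^ (p div 24) * (\<Sum>j<p * Suc n. qpoch (qvar ^ p) j)))) k"
      using A_poly_cong[OF assms(1-3) i_less assms(5,6)]
      by (intro nth_expand_at_one_eq[OF _ k_less]) (simp only: of_int_mult of_int_of_nat_eq mult.assoc)
    finally show ?thesis
      by (simp only: expand_at_one_mult expand_at_one_of_int expand_at_one_power expand_at_one_qvar
          expand_at_one_sum_qpoch f_def)
  qed
  moreover have "Kronecker_symbol 12 (int p) = Legendre 12 (int p)"
    using assms(1,2) by (intro Kronecker_symbol_odd_prime) auto
  moreover have "fps_nth (of_int c * g) k = c * fps_nth g k" for c :: int and g
    using fps_of_int[of c, where ?'a = int] by (metis fps_mult_left_const_nth of_int_eq_id id_apply)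
  ultimately show ?thesis by (simp only:)
qed

end
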